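(* Every \textsc{flipping coins} position is a number; that is, its value as a combinatorial game is equal to a dyadic rational.
   Context: \textsc{Flipping coins}: a position is a finite string $d_1d_2\ldots d_n$ with each $d_i\in\{0,1\}$ (written left to right). Any $0$s after the last $1$ are deleted, so a position is either empty or ends in $1$. A Left move chooses indices $i<j$ with $d_i=d_j=1$ and changes both to $0$. A Right move chooses indices $k<\ell$ with $d_k=0$ and $d_\ell=1$, and changes $d_k$ to $1$ and $d_\ell$ to $0$. After any move, all $0$s following the last $1$ are deleted. The game is played under normal play (a player unable to move loses), and positions are regarded as short partizan combinatorial games. *)

theory Defs
  imports Main "HOL-Library.FSet"
begin

section \<open>Short partizan games under normal play\<close>

datatype game = Game (left_opts: "game fset") (right_opts: "game fset")

lemma size_left_opts [termination_simp]: "x |\<in>| left_opts G \<Longrightarrow> size x < size G"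
proof -
  assume "x |\<in>| left_opts G"
  moreover obtain L R where G: "G = Game L R" by (cases G)
  ultimately have "Suc (size x) \<le> (\<Sum>y\<in>fset L. Suc (size y))"
    using member_le_sum[of x "fset L" "\<lambda>y. Suc (size y)"] by auto
  then show ?thesis using G by simp
qed

lemma size_right_opts [termination_simp]: "x |\<in>| right_opts G \<Longrightarrow> size x < size G"
proof -
  assume "x |\<in>| right_opts G"
  moreover obtain L R where G: "G = Game L R" by (cases G)
  ultimately have "Suc (size x) \<le> (\<Sum>y\<in>fset R. Suc (size y))"
    using member_le_sum[of x "fset R" "\<lambda>y. Suc (size y)"] by auto
  then show ?thesis using G by simp
qed

text \<open>A player wins moving first iff some move leads to a game that the opponent, moving first,
  does not win; in particular a player unable to move loses.\<close>

function left_wins_first :: "game \<Rightarrow> bool" and right_wins_first :: "game \<Rightarrow> bool" where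
  "left_wins_first G \<longleftrightarrow> fBex (left_opts G) (\<lambda>G'. \<not> right_wins_first G')"
| "right_wins_first G \<longleftrightarrow> fBex (right_opts G) (\<lambda>G'. \<not> left_wins_first G')"
  by pat_completeness auto
termination
  by (relation "measure (case_sum size size)") (auto simp: size_left_opts size_right_opts)

declare left_wins_first.simps [simp del] right_wins_first.simps [simp del]

text \<open>The four outcome classes N, L, R, P are the pairs (True, True), (True, False),
  (False, True), (False, False).\<close>

definition outcome :: "game \<Rightarrow> bool \<times> bool" where
  "outcome G = (left_wins_first G, right_wins_first G)"

lemma fimage_fundef_cong [fundef_cong]:
  "M = N \<Longrightarrow> (\<And>x. x |\<in>| N \<Longrightarrow> f x = g x) \<Longrightarrow> f |`| M = g |`| N"
  by (rule fimage_cong)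

text \<open>Disjunctive sum.\<close>

function game_add :: "game \<Rightarrow> game \<Rightarrow> game" where
  "game_add G H =
     Game (((\<lambda>G'. game_add G' H) |`| left_opts G) |\<union>| ((\<lambda>H'. game_add G H') |`| left_opts H))
          (((\<lambda>G'. game_add G' H) |`| right_opts G) |\<union>| ((\<lambda>H'. game_add G H') |`| right_opts H))"
  by pat_completeness auto
termination
  by (relation "measure (\<lambda>(G, H). size G + size H)") (auto simp: size_left_opts size_right_opts)

declare game_add.simps [simp del]

text \<open>Two games have the same value iff they are interchangeable in every disjunctive sum.\<close>

definition game_eq :: "game \<Rightarrow> game \<Rightarrow> bool"  (infix \<open>=\<^sub>g\<close> 50) where
  "G =\<^sub>g H \<longleftrightarrow> (\<forall>X. outcome (game_add G X) = outcome (game_add H X))"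


section \<open>Dyadic rationals as games\<close>

text \<open>$0 = \{\mid\}$, $n + 1 = \{n \mid\}$ and $-(n + 1) = \{\mid -n\}$.\<close>

function int_game :: "int \<Rightarrow> game" where
  "int_game m =
     (if m = 0 then Game {||} {||}
      else if m > 0 then Game {|int_game (m - 1)|} {||}
      else Game {||} {|int_game (m + 1)|})"
  by pat_completeness auto
termination
  by (relation "measure (\<lambda>m. nat \<bar>m\<bar>)") auto

declare int_game.simps [simp del]

text \<open>\<open>dyadic_game m n\<close> is the canonical game of $m / 2^n$. Fractions are first reduced to lowest
  terms; for odd $m$ the definition is
  $m / 2^{n+1} = \{ (m-1) / 2^{n+1} \mid (m+1) / 2^{n+1} \}$,
  with both options reduced once.\<close>

fun dyadic_game :: "int \<Rightarrow> nat \<Rightarrow> game" where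
  "dyadic_game m 0 = int_game m"
| "dyadic_game m (Suc n) =
     (if even m then dyadic_game (m div 2) n
      else Game {|dyadic_game ((m - 1) div 2) n|} {|dyadic_game ((m + 1) div 2) n|})"


section \<open>Flipping coins\<close>

text \<open>The string $d_1 \ldots d_n$ is a list of Booleans, \<open>True\<close> standing for $1$; the list index
  \<open>i\<close> denotes $d_{i+1}$.\<close>

definition strip_zeros :: "bool list \<Rightarrow> bool list" where
  "strip_zeros ds = rev (dropWhile Not (rev ds))"

definition position :: "bool list \<Rightarrow> bool" where
  "position ds \<longleftrightarrow> ds = [] \<or> last ds"

definition left_moves :: "bool list \<Rightarrow> bool list list" where
  "left_moves ds =
     [strip_zeros (ds[i := False, j := False]).
        j \<leftarrow> [0..<length ds], i \<leftarrow> [0..<j], ds ! i \<and> ds ! j]"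

definition right_moves :: "bool list \<Rightarrow> bool list list" where
  "right_moves ds =
     [strip_zeros (ds[k := True, l := False]).
        l \<leftarrow> [0..<length ds], k \<leftarrow> [0..<l], \<not> ds ! k \<and> ds ! l]"

text \<open>Play terminates because every move decreases $\sum_i d_i 2^i$.\<close>

definition weight :: "bool list \<Rightarrow> nat" where
  "weight ds = horner_sum of_bool 2 ds"

lemma weight_strip_zeros: "weight (strip_zeros ds) = weight ds"
proof (induction ds rule: rev_induct)
  case (snoc d ds)
  then show ?case
    by (cases d) (auto simp: strip_zeros_def weight_def horner_sum_append)
qed (simp add: strip_zeros_def)

lemma weight_update:
  "i < length ds \<Longrightarrow> weight (ds[i := b]) + of_bool (ds ! i) * 2 ^ i = weight ds + of_bool b * 2 ^ i"
proof (induction ds arbitrary: i)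
  case (Cons d ds)
  show ?case
  proof (cases i)
    case (Suc j)
    then have "weight (ds[j := b]) + of_bool (ds ! j) * 2 ^ j = weight ds + of_bool b * 2 ^ j"
      using Cons by simp
    then have "2 * (weight (ds[j := b]) + of_bool (ds ! j) * 2 ^ j) = 2 * (weight ds + of_bool b * 2 ^ j)"
      by (rule arg_cong)
    then show ?thesis using Suc by (simp add: weight_def algebra_simps)
  qed (simp add: weight_def)
qed simp

lemma left_moves_weight:
  assumes "es \<in> set (left_moves ds)"
  shows "weight es < weight ds"
proof -
  obtain i j where ij: "i < j" "j < length ds" "ds ! i" "ds ! j"
    and es: "es = strip_zeros (ds[i := False, j := False])"
    using assms by (auto simp: left_moves_def split: if_splits)
  have "weight (ds[i := False]) + 2 ^ i = weight ds"
    using weight_update[of i ds False] ij by simp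
  moreover have "weight (ds[i := False, j := False]) + 2 ^ j = weight (ds[i := False])"
    using weight_update[of j "ds[i := False]" False] ij by simp
  moreover have "(0::nat) < 2 ^ i" by simp
  ultimately show ?thesis
    unfolding es weight_strip_zeros by linarith
qed

lemma right_moves_weight:
  assumes "es \<in> set (right_moves ds)"
  shows "weight es < weight ds"
proof -
  obtain k l where kl: "k < l" "l < length ds" "\<not> ds ! k" "ds ! l"
    and es: "es = strip_zeros (ds[k := True, l := False])"
    using assms by (auto simp: right_moves_def split: if_splits)
  have "weight (ds[k := True]) = weight ds + 2 ^ k"
    using weight_update[of k ds True] kl by simp
  moreover have "weight (ds[k := True, l := False]) + 2 ^ l = weight (ds[k := True])"
    using weight_update[of l "ds[k := True]" False] kl by simp
  moreover have "(2::nat) ^ k < 2 ^ l" using kl by simp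
  ultimately show ?thesis
    unfolding es weight_strip_zeros by linarith
qed

function coins_game :: "bool list \<Rightarrow> game" where
  "coins_game ds =
     Game (fset_of_list (map coins_game (left_moves ds)))
          (fset_of_list (map coins_game (right_moves ds)))"
  by pat_completeness auto
termination
  by (relation "measure weight") (auto simp: left_moves_weight right_moves_weight)

declare coins_game.simps [simp del]

end

(* Every option of a dyadic game is a dyadic game of strictly smaller size. Hence, if the options
   of G all have dyadic values and no right option is at most a left option, G equals the dyadic
   game of least size lying strictly between its left and its right values.

   Flipping coins satisfies this. Let Left flip i and j and let Right flip k and l. If l is neither
   i nor j, the two moves commute and L < LR = RL < R. Otherwise Left can answer Right's move by
   flipping k and the remaining one of i and j, which leads to L itself, so L < R. *)
theory Submission
  imports Defs Complex_Main
begin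

section \<open>Conway's order and its monotonicity for outcomes of sums\<close>

section \<open>The order on games\<close>

text \<open>Conway's order, by recursion on options. Unlike \<open>game_eq\<close>, which quantifies
  over all summands, it lends itself to induction on sizes.\<close>

function game_le :: "game \<Rightarrow> game \<Rightarrow> bool"  (infix \<open>\<le>\<^sub>g\<close> 50) where
  "G \<le>\<^sub>g H \<longleftrightarrow> fBall (left_opts G) (\<lambda>G'. \<not> H \<le>\<^sub>g G') \<and> fBall (right_opts H) (\<lambda>H'. \<not> H' \<le>\<^sub>g G)"
  by pat_completeness auto
termination
  by (relation "measure (\<lambda>(G, H). size G + size H)") (auto simp: size_left_opts size_right_opts)

declare game_le.simps [simp del]

lemma game_le_iff:
  "G \<le>\<^sub>g H \<longleftrightarrow> (\<forall>G'. G' |\<in>| left_opts G \<longrightarrow> \<not> H \<le>\<^sub>g G') \<and> (\<forall>H'. H' |\<in>| right_opts H \<longrightarrow> \<not> H' \<le>\<^sub>g G)"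
  by (subst game_le.simps) blast

text \<open>If \<open>G\<close> were at most its own left option \<open>G'\<close>, then the clause
  on left options would forbid \<open>G' \<le>\<^sub>g G'\<close>, which the induction provides.
  Right options are dual.\<close>

lemma game_le_refl: "G \<le>\<^sub>g G"
proof (induction "size G" arbitrary: G rule: less_induct)
  case less
  have "\<not> G \<le>\<^sub>g G'" if "G' |\<in>| left_opts G" for G'
    using less[OF size_left_opts[OF that]] that game_le_iff[of G G'] by blast
  moreover have "\<not> G' \<le>\<^sub>g G" if "G' |\<in>| right_opts G" for G'
    using less[OF size_right_opts[OF that]] that game_le_iff[of G' G] by blast
  ultimately show ?case
    using game_le_iff[of G G] by blast
qed

lemma not_le_left_opt: "G' |\<in>| left_opts G \<Longrightarrow> \<not> G \<le>\<^sub>g G'"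
  using game_le_refl[of G] game_le_iff by blast

lemma not_right_opt_le: "G' |\<in>| right_opts G \<Longrightarrow> \<not> G' \<le>\<^sub>g G"
  using game_le_refl[of G] game_le_iff by blast

text \<open>A left option \<open>G'\<close> above \<open>K\<close> would be above \<open>H\<close>
  by induction, against \<open>G \<le>\<^sub>g H\<close>. The three games change places in the
  induction, hence the sum of all sizes as measure.\<close>

lemma game_le_trans: "G \<le>\<^sub>g H \<Longrightarrow> H \<le>\<^sub>g K \<Longrightarrow> G \<le>\<^sub>g K"
proof (induction "size G + size H + size K" arbitrary: G H K rule: less_induct)
  case less
  have "\<not> K \<le>\<^sub>g G'" if "G' |\<in>| left_opts G" for G'
  proof
    assume "K \<le>\<^sub>g G'"
    then have "H \<le>\<^sub>g G'"
      using less(1)[of H K G'] less(3) size_left_opts[OF that] by simp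
    then show False
      using less(2) that game_le_iff[of G H] by blast
  qed
  moreover have "\<not> K' \<le>\<^sub>g G" if "K' |\<in>| right_opts K" for K'
  proof
    assume "K' \<le>\<^sub>g G"
    then have "K' \<le>\<^sub>g H"
      using less(1)[of K' G H] less(2) size_right_opts[OF that] by simp
    then show False
      using less(3) that game_le_iff[of H K] by blast
  qed
  ultimately show ?case
    using game_le_iff[of G K] by blast
qed

lemma left_opts_game_add:
  "left_opts (game_add G X) =
     (\<lambda>G'. game_add G' X) |`| left_opts G |\<union>| game_add G |`| left_opts X"
  by (subst game_add.simps) simp

lemma right_opts_game_add:
  "right_opts (game_add G X) =
     (\<lambda>G'. game_add G' X) |`| right_opts G |\<union>| game_add G |`| right_opts X"
  by (subst game_add.simps) simp

lemma left_wins_first_add_iff: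
  "left_wins_first (game_add G X) \<longleftrightarrow>
     (\<exists>G'. G' |\<in>| left_opts G \<and> \<not> right_wins_first (game_add G' X)) \<or>
     (\<exists>X'. X' |\<in>| left_opts X \<and> \<not> right_wins_first (game_add G X'))"
  by (subst left_wins_first.simps) (auto simp: left_opts_game_add)

lemma right_wins_first_add_iff:
  "right_wins_first (game_add G X) \<longleftrightarrow>
     (\<exists>G'. G' |\<in>| right_opts G \<and> \<not> left_wins_first (game_add G' X)) \<or>
     (\<exists>X'. X' |\<in>| right_opts X \<and> \<not> left_wins_first (game_add G X'))"
  by (subst right_wins_first.simps) (auto simp: right_opts_game_add)

text \<open>Strategy copying: a winning move in \<open>X\<close> is repeated, and a winning move in
  one game is either matched in the other or reversed by the opponent. Each half at \<open>X\<close>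
  rests on the other half at an option, so both are proved at once.\<close>

lemma game_le_imp_wins:
  assumes "G \<le>\<^sub>g H"
  shows "(left_wins_first (game_add G X) \<longrightarrow> left_wins_first (game_add H X)) \<and>
         (right_wins_first (game_add H X) \<longrightarrow> right_wins_first (game_add G X))"
  using assms
proof (induction "size G + size H + size X" arbitrary: G H X rule: less_induct)
  case less
  have IH: "(left_wins_first (game_add G' X') \<longrightarrow> left_wins_first (game_add H' X')) \<and>
         (right_wins_first (game_add H' X') \<longrightarrow> right_wins_first (game_add G' X'))"
    if "size G' + size H' + size X' < size G + size H + size X" "G' \<le>\<^sub>g H'" for G' H' X'
    using less(1) that by blast
  have "left_wins_first (game_add H X)" if "left_wins_first (game_add G X)"
    using that unfolding left_wins_first_add_iff[of G]
  proof (elim disjE exE conjE)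
    fix X' assume "X' |\<in>| left_opts X" "\<not> right_wins_first (game_add G X')"
    then show ?thesis
      using IH[of G H X'] less(2) size_left_opts left_wins_first_add_iff[of H X] by auto
  next
    fix G' assume G': "G' |\<in>| left_opts G" "\<not> right_wins_first (game_add G' X)"
    note sG = size_left_opts[OF G'(1)]
    have "\<not> H \<le>\<^sub>g G'" using less(2) G'(1) game_le_iff[of G H] by blast
    then consider H' where "H' |\<in>| left_opts H" "G' \<le>\<^sub>g H'"
      | K where "K |\<in>| right_opts G'" "K \<le>\<^sub>g H"
      using game_le_iff[of H G'] by blast
    then show ?thesis
    proof cases
      case 1
      then show ?thesis
        using IH[of G' H' X] G'(2) sG size_left_opts[OF 1(1)] left_wins_first_add_iff[of H X] by auto
    next
      case 2
      \<comment> \<open>\<open>K\<close> is a possible reply of Right to \<open>G'\<close>. As Right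
        does not win there moving first, Left wins after that reply, and
        \<open>K \<le>\<^sub>g H\<close> carries the win over to \<open>H\<close>.\<close>
      then have "left_wins_first (game_add K X)"
        using G'(2) right_wins_first_add_iff[of G' X] by blast
      then show ?thesis
        using IH[of K H X] 2 sG size_right_opts[OF 2(1)] by auto
    qed
  qed
  moreover have "right_wins_first (game_add G X)" if "right_wins_first (game_add H X)"
    using that unfolding right_wins_first_add_iff[of H]
  proof (elim disjE exE conjE)
    fix X' assume "X' |\<in>| right_opts X" "\<not> left_wins_first (game_add H X')"
    then show ?thesis
      using IH[of G H X'] less(2) size_right_opts right_wins_first_add_iff[of G X] by auto
  next
    fix H' assume H': "H' |\<in>| right_opts H" "\<not> left_wins_first (game_add H' X)"
    note sH = size_right_opts[OF H'(1)]
    have "\<not> H' \<le>\<^sub>g G" using less(2) H'(1) game_le_iff[of G H] by blast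
    then consider G' where "G' |\<in>| right_opts G" "G' \<le>\<^sub>g H'"
      | K where "K |\<in>| left_opts H'" "G \<le>\<^sub>g K"
      using game_le_iff[of H' G] by blast
    then show ?thesis
    proof cases
      case 1
      then show ?thesis
        using IH[of G' H' X] H'(2) sH size_right_opts[OF 1(1)] right_wins_first_add_iff[of G X] by auto
    next
      case 2
      then have "right_wins_first (game_add K X)"
        using H'(2) left_wins_first_add_iff[of H' X] by blast
      then show ?thesis
        using IH[of G K X] 2 sH size_left_opts[OF 2(1)] by auto
    qed
  qed
  ultimately show ?case by blast
qed

text \<open>The way back from the recursive order to \<open>game_eq\<close>: monotonicity in both
  directions forces equal outcomes in every sum.\<close>

lemma game_eqI: "G \<le>\<^sub>g H \<Longrightarrow> H \<le>\<^sub>g G \<Longrightarrow> G =\<^sub>g H"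
  using game_le_imp_wins[of G H] game_le_imp_wins[of H G]
  unfolding game_eq_def outcome_def by auto


section \<open>Canonical dyadic games are ordered like their rational values\<close>

section \<open>Dyadic games and their values\<close>

text \<open>A relation, because many pairs \<open>m\<close>, \<open>n\<close> give the same game.
  That \<open>D\<close> determines \<open>x\<close> follows later from \<open>dyadic_le_iff\<close>
  and reflexivity.\<close>

definition dyadic_value :: "game \<Rightarrow> rat \<Rightarrow> bool" where
  "dyadic_value D x \<longleftrightarrow> (\<exists>m n. D = dyadic_game m n \<and> x = of_int m / 2 ^ n)"

lemma dyadic_value_int_game: "dyadic_value (int_game k) (of_int k)"
  unfolding dyadic_value_def by (intro exI[of _ k] exI[of _ "0::nat"]) simp

text \<open>Cancelling factors 2 ends at an integer or at an odd numerator over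
  \<open>2 ^ Suc p\<close>. In the second case the two options have the neighbouring multiples of
  \<open>1 / 2 ^ Suc p\<close> as values. Later proofs need only this distinction, never the
  reduction itself.\<close>

lemma dyadic_value_cases:
  assumes "dyadic_value D x"
  obtains (int) k where "D = int_game k" "x = of_int k"
  | (frac) a p L R where "x = of_int a / 2 ^ Suc p" "D = Game {|L|} {|R|}"
      "dyadic_value L (x - 1 / 2 ^ Suc p)" "dyadic_value R (x + 1 / 2 ^ Suc p)"
proof -
  have "(\<exists>k. dyadic_game m n = int_game k \<and> of_int m / 2 ^ n = (of_int k :: rat)) \<or>
    (\<exists>a p L R. of_int m / 2 ^ n = (of_int a / 2 ^ Suc p :: rat) \<and> dyadic_game m n = Game {|L|} {|R|} \<and>
      dyadic_value L (of_int m / 2 ^ n - 1 / 2 ^ Suc p) \<and>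
      dyadic_value R (of_int m / 2 ^ n + 1 / 2 ^ Suc p))" for m n
  proof (induction n arbitrary: m)
    case (Suc n)
    show ?case
    proof (cases "even m")
      case True
      then obtain c where c: "m = 2 * c" by blast
      have *: "of_int m / 2 ^ Suc n = (of_int c / 2 ^ n :: rat)"
        "dyadic_game m (Suc n) = dyadic_game c n" using c by auto
      show ?thesis unfolding * by (rule Suc)
    next
      case False
      then obtain c where c: "m = 2 * c + 1" by (elim oddE)
      then have "(m - 1) div 2 = c" "(m + 1) div 2 = c + 1" by auto
      then have "dyadic_game m (Suc n) = Game {|dyadic_game c n|} {|dyadic_game (c + 1) n|}"
        using False by simp
      moreover have "dyadic_value (dyadic_game c n) (of_int m / 2 ^ Suc n - 1 / 2 ^ Suc n)"
        unfolding dyadic_value_def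
        by (intro exI[of _ c] exI[of _ n]) (simp add: c field_simps)
      moreover have "dyadic_value (dyadic_game (c + 1) n) (of_int m / 2 ^ Suc n + 1 / 2 ^ Suc n)"
        unfolding dyadic_value_def
        by (intro exI[of _ "c + 1"] exI[of _ n]) (simp add: c field_simps)
      ultimately show ?thesis by blast
    qed
  qed auto
  moreover obtain m n where "D = dyadic_game m n" "x = of_int m / 2 ^ n"
    using assms unfolding dyadic_value_def by blast
  ultimately show ?thesis
    using int frac by blast
qed

lemma left_opts_int_game: "left_opts (int_game k) = (if k > 0 then {|int_game (k - 1)|} else {||})"
  by (subst int_game.simps) simp

lemma right_opts_int_game: "right_opts (int_game k) = (if k < 0 then {|int_game (k + 1)|} else {||})"
  by (subst int_game.simps) simp

lemma dyadic_value_left_opt: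
  assumes "dyadic_value D x" "D' |\<in>| left_opts D"
  obtains y where "dyadic_value D' y" "y < x"
  using assms(1)
proof (cases rule: dyadic_value_cases)
  case (int k)
  then have "D' = int_game (k - 1)"
    using assms(2) by (auto simp: left_opts_int_game split: if_splits)
  then show ?thesis
    using that[of "of_int (k - 1)"] dyadic_value_int_game[of "k - 1"] int by simp
next
  case (frac a p L R)
  then show ?thesis
    using that[of "x - 1 / 2 ^ Suc p"] assms(2) by simp
qed

lemma dyadic_value_right_opt:
  assumes "dyadic_value D x" "D' |\<in>| right_opts D"
  obtains y where "dyadic_value D' y" "x < y"
  using assms(1)
proof (cases rule: dyadic_value_cases)
  case (int k)
  then have "D' = int_game (k + 1)"
    using assms(2) by (auto simp: right_opts_int_game split: if_splits)
  then show ?thesis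
    using that[of "of_int (k + 1)"] dyadic_value_int_game[of "k + 1"] int by simp
next
  case (frac a p L R)
  then show ?thesis
    using that[of "x + 1 / 2 ^ Suc p"] assms(2) by simp
qed

text \<open>Over the common denominator \<open>2 ^ n\<close> both numerators are integers, and
  distinct integers differ by at least 1.\<close>

lemma dyadic_gap:
  assumes "y < x" "x = of_int a / 2 ^ n" "y = (of_int b / 2 ^ m :: rat)" "m \<le> n"
  shows "y \<le> x - 1 / 2 ^ n" "y + 1 / 2 ^ n \<le> x"
proof -
  define c where "c = b * 2 ^ (n - m)"
  have "(2::rat) ^ n = 2 ^ m * 2 ^ (n - m)"
    using assms(4) by (simp flip: power_add)
  then have y: "y = of_int c / 2 ^ n"
    by (simp add: assms(3) c_def)
  then have "(of_int c :: rat) < of_int a"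
    using assms(1,2) by (simp add: divide_less_cancel)
  then have "c + 1 \<le> a" by simp
  then have "(of_int (c + 1) :: rat) \<le> of_int a" by (simp only: of_int_le_iff)
  then have "of_int (c + 1) / 2 ^ n \<le> (of_int a / 2 ^ n :: rat)"
    by (rule divide_right_mono) simp
  then show "y \<le> x - 1 / 2 ^ n" "y + 1 / 2 ^ n \<le> x"
    using y assms(2) by (simp_all add: add_divide_distrib)
qed

text \<open>The number with the finer denominator has an option one step towards the other number,
  and by \<open>dyadic_gap\<close> that step does not overshoot.\<close>

lemma dyadic_value_less:
  assumes x: "dyadic_value D x" and y: "dyadic_value E y" and less: "y < x"
  shows "(\<exists>D' z. D' |\<in>| left_opts D \<and> dyadic_value D' z \<and> y \<le> z) \<or>
         (\<exists>E' z. E' |\<in>| right_opts E \<and> dyadic_value E' z \<and> z \<le> x)"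
  using x
proof (cases rule: dyadic_value_cases)
  case x: (int k)
  show ?thesis using y
  proof (cases rule: dyadic_value_cases)
    case y: (int l)
    have lk: "l < k" using less x y by simp
    \<comment> \<open>If \<open>k\<close> is positive, its left option \<open>k - 1\<close> is still
      at least \<open>l\<close>. Otherwise \<open>l\<close> is negative and has the right option
      \<open>l + 1\<close>, which is at most \<open>k\<close>.\<close>
    show ?thesis
    proof (cases "k > 0")
      case True
      then show ?thesis
        using lk x y dyadic_value_int_game[of "k - 1"]
        by (auto simp: left_opts_int_game intro!: exI[of _ "of_int (k - 1)"])
    next
      case False
      then have "int_game (l + 1) |\<in>| right_opts E" "of_int (l + 1) \<le> x"
        using lk x y by (auto simp: right_opts_int_game)
      then show ?thesis
        using dyadic_value_int_game[of "l + 1"] by blast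
    qed
  next
    case y: (frac b q L R)
    have "y + 1 / 2 ^ Suc q \<le> x"
      using dyadic_gap(2)[of y x "k * 2 ^ Suc q" "Suc q" b "Suc q"] less x y(1) by simp
    then show ?thesis using y by auto
  qed
next
  case x: (frac a p L R)
  show ?thesis using y
  proof (cases rule: dyadic_value_cases)
    case y: (int l)
    have "y \<le> x - 1 / 2 ^ Suc p"
      using dyadic_gap(1)[of y x a "Suc p" l 0] less x(1) y by simp
    then show ?thesis using x by auto
  next
    case y: (frac b q L' R')
    show ?thesis
    proof (cases "q \<le> p")
      case True
      then have "y \<le> x - 1 / 2 ^ Suc p"
        using dyadic_gap(1)[OF less x(1) y(1)] by simp
      then show ?thesis using x by auto
    next
      case False
      \<comment> \<open>\<open>dyadic_gap\<close> measures the gap at the denominator of the larger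
        number, so \<open>x\<close> is rewritten over the finer denominator of
        \<open>y\<close>.\<close>
      have "x = of_int (a * 2 ^ (q - p)) / 2 ^ Suc q"
      proof -
        have "(2::rat) ^ q = 2 ^ p * 2 ^ (q - p)"
          using False by (simp flip: power_add)
        then show ?thesis using x(1) by simp
      qed
      then have "y + 1 / 2 ^ Suc q \<le> x"
        using dyadic_gap(2)[OF less _ y(1)] by blast
      then show ?thesis using y by auto
    qed
  qed
qed

text \<open>For \<open>x \<le> y\<close>, options lie strictly to their side of the value, so by
  induction none violates the order. For \<open>y < x\<close>, the option from
  \<open>dyadic_value_less\<close> is a violation.\<close>

lemma dyadic_le_iff:
  assumes "dyadic_value D x" "dyadic_value E y"
  shows "D \<le>\<^sub>g E \<longleftrightarrow> x \<le> y"
  using assms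
proof (induction "size D + size E" arbitrary: D E x y rule: less_induct)
  case less
  show ?case
  proof
    assume "x \<le> y"
    have "\<not> E \<le>\<^sub>g D'" if D': "D' |\<in>| left_opts D" for D'
    proof -
      obtain z where "dyadic_value D' z" "z < x"
        using dyadic_value_left_opt[OF less(2) D'] .
      then show ?thesis
        using less(1)[of E D' y z] less(3) size_left_opts[OF D'] \<open>x \<le> y\<close> by simp
    qed
    moreover have "\<not> E' \<le>\<^sub>g D" if E': "E' |\<in>| right_opts E" for E'
    proof -
      obtain z where "dyadic_value E' z" "y < z"
        using dyadic_value_right_opt[OF less(3) E'] .
      then show ?thesis
        using less(1)[of E' D z x] less(2) size_right_opts[OF E'] \<open>x \<le> y\<close> by simp
    qed
    ultimately show "D \<le>\<^sub>g E"
      using game_le_iff[of D E] by blast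
  next
    assume le: "D \<le>\<^sub>g E"
    show "x \<le> y"
    proof (rule ccontr)
      assume "\<not> x \<le> y"
      then consider D' z where "D' |\<in>| left_opts D" "dyadic_value D' z" "y \<le> z"
        | E' z where "E' |\<in>| right_opts E" "dyadic_value E' z" "z \<le> x"
        using dyadic_value_less[OF less(2,3)] by force
      then show False
      proof cases
        case 1
        then have "E \<le>\<^sub>g D'"
          using less(1)[of E D' y z] less(3) size_left_opts[OF 1(1)] by simp
        then show False using le 1 game_le_iff[of D E] by blast
      next
        case 2
        then have "E' \<le>\<^sub>g D"
          using less(1)[of E' D z x] less(2) size_right_opts[OF 2(1)] by simp
        then show False using le 2 game_le_iff[of D E] by blast
      qed
    qed
  qed
qed


section \<open>The simplicity theorem for games with dyadic options\<close>

section \<open>Games equal to numbers\<close>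

definition has_value :: "game \<Rightarrow> rat \<Rightarrow> bool" where
  "has_value G x \<longleftrightarrow> (\<exists>D. dyadic_value D x \<and> G \<le>\<^sub>g D \<and> D \<le>\<^sub>g G)"

lemma has_value_le_iff:
  assumes "has_value G x" "has_value H y"
  shows "G \<le>\<^sub>g H \<longleftrightarrow> x \<le> y"
proof -
  obtain D E where D: "dyadic_value D x" "G \<le>\<^sub>g D" "D \<le>\<^sub>g G"
    and E: "dyadic_value E y" "H \<le>\<^sub>g E" "E \<le>\<^sub>g H"
    using assms unfolding has_value_def by blast
  have "G \<le>\<^sub>g H \<longleftrightarrow> D \<le>\<^sub>g E"
    using D E game_le_trans by blast
  then show ?thesis
    using dyadic_le_iff[OF D(1) E(1)] by blast
qed

lemma dyadic_has_value: "dyadic_value D x \<Longrightarrow> has_value D x"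
  unfolding has_value_def using game_le_refl by blast

lemma has_value_imp_dyadic: "has_value G x \<Longrightarrow> \<exists>D. dyadic_value D x"
  unfolding has_value_def by blast

lemma dyadic_value_midpoint:
  assumes "dyadic_value D x" "dyadic_value E y"
  obtains M where "dyadic_value M ((x + y) / 2)"
proof -
  obtain a n b m where xy: "x = of_int a / 2 ^ n" "y = of_int b / 2 ^ m"
    using assms unfolding dyadic_value_def by blast
  have "(x + y) / 2 = of_int (a * 2 ^ m + b * 2 ^ n) / 2 ^ Suc (n + m)"
    unfolding xy by (simp add: field_simps power_add)
  then show ?thesis
    using that unfolding dyadic_value_def by blast
qed

text \<open>If one side is empty, an integer beyond the other side serves. Otherwise the midpoint of
  the largest lower and the smallest upper bound does.\<close>

lemma dyadic_value_between:
  assumes "finite A" "finite B"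
    and "\<And>a. a \<in> A \<Longrightarrow> \<exists>D. dyadic_value D a" "\<And>b. b \<in> B \<Longrightarrow> \<exists>D. dyadic_value D b"
    and "\<And>a b. a \<in> A \<Longrightarrow> b \<in> B \<Longrightarrow> a < b"
  shows "\<exists>D x. dyadic_value D x \<and> (\<forall>a\<in>A. a < x) \<and> (\<forall>b\<in>B. x < b)"
proof -
  consider "A = {}" | "B = {}" | "A \<noteq> {}" "B \<noteq> {}" by blast
  then show ?thesis
  proof cases
    case 1
    obtain k :: int where "\<forall>b\<in>B. of_int k < b"
    proof (cases "B = {}")
      case False
      have "\<forall>b\<in>B. of_int (\<lfloor>Min B\<rfloor> - 1) < b"
      proof
        fix b assume "b \<in> B"
        then have "Min B \<le> b" using assms(2) by simp
        moreover have "of_int (\<lfloor>Min B\<rfloor> - 1) < Min B" by linarith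
        ultimately show "of_int (\<lfloor>Min B\<rfloor> - 1) < b" by (rule order_less_le_trans[rotated])
      qed
      then show ?thesis using that by blast
    qed (use that in auto)
    then show ?thesis using 1 dyadic_value_int_game by blast
  next
    case 2
    obtain k :: int where "\<forall>a\<in>A. a < of_int k"
    proof (cases "A = {}")
      case False
      have "\<forall>a\<in>A. a < of_int (\<lfloor>Max A\<rfloor> + 1)"
      proof
        fix a assume "a \<in> A"
        then have "a \<le> Max A" using assms(1) by simp
        moreover have "Max A < of_int (\<lfloor>Max A\<rfloor> + 1)" by linarith
        ultimately show "a < of_int (\<lfloor>Max A\<rfloor> + 1)" by (rule order_le_less_trans)
      qed
      then show ?thesis using that by blast
    qed (use that in auto)
    then show ?thesis using 2 dyadic_value_int_game by blast
  next
    case 3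
    then have in_AB: "Max A \<in> A" "Min B \<in> B" using assms(1,2) by auto
    then obtain D E where "dyadic_value D (Max A)" "dyadic_value E (Min B)"
      using assms(3,4) by blast
    then obtain M where M: "dyadic_value M ((Max A + Min B) / 2)"
      using dyadic_value_midpoint by blast
    have "Max A < Min B" using assms(5) in_AB by blast
    then have "Max A < (Max A + Min B) / 2" "(Max A + Min B) / 2 < Min B" by simp_all
    moreover have "\<forall>a\<in>A. a \<le> Max A" "\<forall>b\<in>B. Min B \<le> b" using assms(1,2) by auto
    ultimately show ?thesis using M by (meson order_le_less_trans order_less_le_trans)
  qed
qed

text \<open>The last two assumptions stand in for minimality of \<open>D\<close>. A left option
  \<open>D'\<close> of \<open>D\<close> lies below some left option of \<open>G\<close>, so it
  cannot be above \<open>G\<close>; right options are dual.\<close>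

lemma has_value_simplest:
  assumes D: "dyadic_value D x"
    and left: "\<And>L. L |\<in>| left_opts G \<Longrightarrow> \<exists>l<x. has_value L l"
    and right: "\<And>R. R |\<in>| right_opts G \<Longrightarrow> \<exists>r>x. has_value R r"
    and left_D: "\<And>D'. D' |\<in>| left_opts D \<Longrightarrow> \<exists>L. L |\<in>| left_opts G \<and> D' \<le>\<^sub>g L"
    and right_D: "\<And>D'. D' |\<in>| right_opts D \<Longrightarrow> \<exists>R. R |\<in>| right_opts G \<and> R \<le>\<^sub>g D'"
  shows "has_value G x"
proof -
  have "\<not> D \<le>\<^sub>g L" if "L |\<in>| left_opts G" for L
    using left[OF that] has_value_le_iff[OF dyadic_has_value[OF D]] by fastforce
  moreover have "\<not> D' \<le>\<^sub>g G" if "D' |\<in>| right_opts D" for D'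
    using right_D[OF that] not_right_opt_le game_le_trans by blast
  ultimately have "G \<le>\<^sub>g D"
    using game_le_iff[of G D] by blast
  have "\<not> R \<le>\<^sub>g D" if "R |\<in>| right_opts G" for R
    using right[OF that] has_value_le_iff[OF _ dyadic_has_value[OF D]] by fastforce
  moreover have "\<not> G \<le>\<^sub>g D'" if "D' |\<in>| left_opts D" for D'
    using left_D[OF that] not_le_left_opt game_le_trans by blast
  ultimately have "D \<le>\<^sub>g G"
    using game_le_iff[of D G] by blast
  with D \<open>G \<le>\<^sub>g D\<close> show ?thesis
    unfolding has_value_def by blast
qed

lemma has_value_if_opts_separated:
  assumes "\<And>L. L |\<in>| left_opts G \<Longrightarrow> \<exists>l. has_value L l"
    and "\<And>R. R |\<in>| right_opts G \<Longrightarrow> \<exists>r. has_value R r"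
    and sep: "\<And>L R. L |\<in>| left_opts G \<Longrightarrow> R |\<in>| right_opts G \<Longrightarrow> \<not> R \<le>\<^sub>g L"
  shows "\<exists>x. has_value G x"
proof -
  define v where "v H = (SOME x. has_value H x)" for H
  have vl: "has_value L (v L)" if "L |\<in>| left_opts G" for L
    unfolding v_def using assms(1)[OF that] by (rule someI_ex)
  have vr: "has_value R (v R)" if "R |\<in>| right_opts G" for R
    unfolding v_def using assms(2)[OF that] by (rule someI_ex)
  define A where "A = v ` fset (left_opts G)"
  define B where "B = v ` fset (right_opts G)"
  define P where "P D x \<longleftrightarrow> dyadic_value D x \<and> (\<forall>a\<in>A. a < x) \<and> (\<forall>b\<in>B. x < b)" for D x
  have "\<exists>D x. P D x"
    unfolding P_def
  proof (rule dyadic_value_between)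
    show "\<exists>D. dyadic_value D a" if "a \<in> A" for a
      using that has_value_imp_dyadic[OF vl] unfolding A_def by blast
    show "\<exists>D. dyadic_value D b" if "b \<in> B" for b
      using that has_value_imp_dyadic[OF vr] unfolding B_def by blast
    show "a < b" if ab: "a \<in> A" "b \<in> B" for a b
    proof -
      obtain L R where "L |\<in>| left_opts G" "a = v L" "R |\<in>| right_opts G" "b = v R"
        using ab unfolding A_def B_def by blast
      then show ?thesis
        using sep[of L R] has_value_le_iff[OF vr vl, of R L] by simp
    qed
  qed (simp_all add: A_def B_def)
  \<comment> \<open>Simplicity is measured by the size of the game: among all separating dyadic
    games one of least size is taken.\<close>
  then obtain D where "\<exists>x. P D x" and "\<forall>E. (\<exists>x. P E x) \<longrightarrow> size D \<le> size E"
    using ex_has_least_nat[of "\<lambda>D. \<exists>x. P D x" _ size] by blast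
  then have min: "\<not> P E x" if "size E < size D" for E x
    using that leD by blast
  from \<open>\<exists>x. P D x\<close> obtain x where D: "dyadic_value D x"
    and A: "\<forall>a\<in>A. a < x" and B: "\<forall>b\<in>B. x < b"
    unfolding P_def by blast
  have "has_value G x"
  proof (rule has_value_simplest[OF D])
    fix D' assume D': "D' |\<in>| left_opts D"
    obtain y where y: "dyadic_value D' y" "y < x"
      using dyadic_value_left_opt[OF D D'] .
    \<comment> \<open>\<open>D'\<close> is smaller than \<open>D\<close>, so \<open>y\<close> does
      not separate. Being less than \<open>x\<close>, it is below every right value, hence some left
      value is at least \<open>y\<close>.\<close>
    have "\<not> P D' y" using min[OF size_left_opts[OF D']] .
    moreover have "\<forall>b\<in>B. y < b" using y(2) B by auto
    ultimately obtain a where "a \<in> A" "y \<le> a"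
      using y(1) unfolding P_def by (meson not_less)
    then obtain L where "L |\<in>| left_opts G" "y \<le> v L"
      unfolding A_def by blast
    then show "\<exists>L. L |\<in>| left_opts G \<and> D' \<le>\<^sub>g L"
      using has_value_le_iff[OF dyadic_has_value[OF y(1)] vl] by blast
  next
    fix D' assume D': "D' |\<in>| right_opts D"
    obtain y where y: "dyadic_value D' y" "x < y"
      using dyadic_value_right_opt[OF D D'] .
    have "\<not> P D' y" using min[OF size_right_opts[OF D']] .
    moreover have "\<forall>a\<in>A. a < y" using y(2) A by auto
    ultimately obtain b where "b \<in> B" "b \<le> y"
      using y(1) unfolding P_def by (meson not_less)
    then obtain R where "R |\<in>| right_opts G" "v R \<le> y"
      unfolding B_def by blast
    then show "\<exists>R. R |\<in>| right_opts G \<and> R \<le>\<^sub>g D'"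
      using has_value_le_iff[OF vr dyadic_has_value[OF y(1)]] by blast
  qed (use A B vl vr in \<open>auto simp: A_def B_def\<close>)
  then show ?thesis ..
qed


section \<open>Moves as operations on sets of ones, and separation of the options\<close>

section \<open>Flipping coins\<close>

text \<open>Trailing zeros leave no trace in this set, so stripping becomes invisible and moves turn
  into set operations.\<close>

definition ones :: "bool list \<Rightarrow> nat set" where
  "ones ds = {i. i < length ds \<and> ds ! i}"

lemma ones_list_update:
  "i < length ds \<Longrightarrow> ones (ds[i := b]) = (if b then insert i (ones ds) else ones ds - {i})"
  by (auto simp: ones_def nth_list_update)

lemma ones_strip_zeros: "ones (strip_zeros ds) = ones ds"
proof (induction ds rule: rev_induct)
  case (snoc d ds)
  have "ones (ds @ [False]) = ones ds"
    by (auto simp: ones_def nth_append split: if_splits)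
  with snoc show ?case
    by (cases d) (simp_all add: strip_zeros_def)
qed (simp add: strip_zeros_def)

lemma position_strip_zeros: "position (strip_zeros ds)"
proof (induction ds rule: rev_induct)
  case (snoc d ds)
  then show ?case
    by (cases d) (auto simp: strip_zeros_def position_def)
qed (simp add: strip_zeros_def position_def)

lemma position_length_le:
  assumes "position ds" "ones ds \<subseteq> ones es"
  shows "length ds \<le> length es"
proof (cases "ds = []")
  case False
  then have "length ds - 1 \<in> ones ds"
    using assms(1) by (auto simp: position_def ones_def last_conv_nth)
  then show ?thesis
    using assms(2) by (auto simp: ones_def)
qed simp

text \<open>The last index of a nonempty position is a one, so the set of ones fixes the length and
  then every entry.\<close>

lemma position_eqI:
  assumes "position ds" "position es" "ones ds = ones es"
  shows "ds = es"
proof (rule nth_equalityI)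
  show len: "length ds = length es"
    using assms position_length_le by (simp add: le_antisym)
  show "ds ! i = es ! i" if "i < length ds" for i
    using that len assms(3) by (auto simp: ones_def set_eq_iff)
qed

text \<open>Left's two coins play symmetric roles, so \<open>i < j\<close> is relaxed to
  \<open>i \<noteq> j\<close>. Later arguments can then name a pair of coins without sorting
  it.\<close>

lemma left_moves_iff:
  "es \<in> set (left_moves ds) \<longleftrightarrow> position es \<and>
     (\<exists>i j. i \<in> ones ds \<and> j \<in> ones ds \<and> i \<noteq> j \<and> ones es = ones ds - {i, j})"
proof -
  let ?flip = "\<lambda>i j. strip_zeros (ds[i := False, j := False])"
  have ones_flip: "ones (?flip i j) = ones ds - {i, j}" if "i \<in> ones ds" "j \<in> ones ds" for i j
  proof -
    have "i < length ds" "j < length ds" using that by (auto simp: ones_def)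
    then show ?thesis unfolding ones_strip_zeros by (auto simp: ones_list_update)
  qed
  have flip_iff: "es = ?flip i j \<longleftrightarrow> position es \<and> ones es = ones ds - {i, j}"
    if "i \<in> ones ds" "j \<in> ones ds" for i j
    using ones_flip[OF that] position_strip_zeros[of "ds[i := False, j := False]"]
      position_eqI[of es "?flip i j"] by auto
  have "es \<in> set (left_moves ds) \<longleftrightarrow> (\<exists>i j. i \<in> ones ds \<and> j \<in> ones ds \<and> i < j \<and>
      es = ?flip i j)"
  proof
    assume "es \<in> set (left_moves ds)"
    then obtain i j where "i < j" "j < length ds" "ds ! i" "ds ! j" "es = ?flip i j"
      by (auto simp: left_moves_def)
    then show "\<exists>i j. i \<in> ones ds \<and> j \<in> ones ds \<and> i < j \<and> es = ?flip i j"
      by (intro exI[of _ i] exI[of _ j]) (simp add: ones_def)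
  next
    assume "\<exists>i j. i \<in> ones ds \<and> j \<in> ones ds \<and> i < j \<and> es = ?flip i j"
    then obtain i j where "i < j" "j < length ds" "ds ! i" "ds ! j" "es = ?flip i j"
      by (auto simp: ones_def)
    \<comment> \<open>The quantifiers follow the nesting of the comprehension in
      \<open>left_moves\<close>: \<open>j\<close> outside, \<open>i\<close> inside.\<close>
    then have "\<exists>j\<in>{0..<length ds}. \<exists>i\<in>{0..<j} \<inter> {i. ds ! i \<and> ds ! j}. es = ?flip i j"
      by (intro bexI[where x = j] bexI[where x = i]) simp_all
    then show "es \<in> set (left_moves ds)"
      by (auto simp: left_moves_def)
  qed
  also have "\<dots> \<longleftrightarrow> position es \<and>
     (\<exists>i j. i \<in> ones ds \<and> j \<in> ones ds \<and> i < j \<and> ones es = ones ds - {i, j})"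
    using flip_iff by blast
  also have "\<dots> \<longleftrightarrow> position es \<and>
     (\<exists>i j. i \<in> ones ds \<and> j \<in> ones ds \<and> i \<noteq> j \<and> ones es = ones ds - {i, j})"
    by (auto simp: insert_commute neq_iff)
  finally show ?thesis .
qed

text \<open>Here the order of the indices stays: \<open>k < l\<close> also keeps \<open>k\<close>
  within the list, which \<open>k \<notin> ones ds\<close> alone does not.\<close>

lemma right_moves_iff:
  "es \<in> set (right_moves ds) \<longleftrightarrow> position es \<and>
     (\<exists>k l. k < l \<and> k \<notin> ones ds \<and> l \<in> ones ds \<and> ones es = insert k (ones ds) - {l})"
proof -
  let ?flip = "\<lambda>k l. strip_zeros (ds[k := True, l := False])"
  have ones_flip: "ones (?flip k l) = insert k (ones ds) - {l}" if "k < l" "l \<in> ones ds" for k l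
  proof -
    have "k < length ds" "l < length ds" using that by (auto simp: ones_def)
    then show ?thesis unfolding ones_strip_zeros by (simp add: ones_list_update)
  qed
  have flip_iff: "es = ?flip k l \<longleftrightarrow> position es \<and> ones es = insert k (ones ds) - {l}"
    if "k < l" "l \<in> ones ds" for k l
    using ones_flip[OF that] position_strip_zeros[of "ds[k := True, l := False]"]
      position_eqI[of es "?flip k l"] by auto
  have "es \<in> set (right_moves ds) \<longleftrightarrow> (\<exists>k l. k < l \<and> k \<notin> ones ds \<and> l \<in> ones ds \<and>
      es = ?flip k l)"
  proof
    assume "es \<in> set (right_moves ds)"
    then obtain k l where "k < l" "l < length ds" "\<not> ds ! k" "ds ! l" "es = ?flip k l"
      by (auto simp: right_moves_def)
    then show "\<exists>k l. k < l \<and> k \<notin> ones ds \<and> l \<in> ones ds \<and> es = ?flip k l"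
      by (intro exI[of _ k] exI[of _ l]) (simp add: ones_def)
  next
    assume "\<exists>k l. k < l \<and> k \<notin> ones ds \<and> l \<in> ones ds \<and> es = ?flip k l"
    then obtain k l where "k < l" "l < length ds" "\<not> ds ! k" "ds ! l" "es = ?flip k l"
      by (auto simp: ones_def)
    then have "\<exists>l\<in>{0..<length ds}. \<exists>k\<in>{0..<l} \<inter> {k. \<not> ds ! k \<and> ds ! l}. es = ?flip k l"
      by (intro bexI[where x = l] bexI[where x = k]) simp_all
    then show "es \<in> set (right_moves ds)"
      by (auto simp: right_moves_def)
  qed
  also have "\<dots> \<longleftrightarrow> position es \<and>
     (\<exists>k l. k < l \<and> k \<notin> ones ds \<and> l \<in> ones ds \<and> ones es = insert k (ones ds) - {l})"
    using flip_iff by blast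
  finally show ?thesis .
qed

text \<open>Being a zero of \<open>ds\<close>, \<open>k\<close> differs from \<open>i\<close> and
  \<open>j\<close>, so the moves can clash only at \<open>l\<close>.\<close>

lemma moves_interact:
  assumes "es \<in> set (left_moves ds)" "fs \<in> set (right_moves ds)"
  shows "es \<in> set (left_moves fs) \<or> (\<exists>gs. gs \<in> set (right_moves es) \<and> gs \<in> set (left_moves fs))"
proof -
  obtain i j where es: "position es" "i \<in> ones ds" "j \<in> ones ds" "i \<noteq> j" "ones es = ones ds - {i, j}"
    using assms(1) left_moves_iff by blast
  obtain k l where kl: "k < l" "k \<notin> ones ds" "l \<in> ones ds"
    and fs: "ones fs = insert k (ones ds) - {l}"
    using assms(2) right_moves_iff by blast
  consider "l = i" | "l = j" | "l \<noteq> i" "l \<noteq> j" by blast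
  then show ?thesis
  proof cases
    case 1
    \<comment> \<open>Right has already cleared \<open>i\<close>, so Left undoes \<open>k\<close>
      and clears \<open>j\<close>.\<close>
    then have "ones es = ones fs - {k, j}" "k \<in> ones fs" "j \<in> ones fs" "k \<noteq> j"
      using es kl fs by auto
    then show ?thesis using es(1) left_moves_iff by blast
  next
    case 2
    then have "ones es = ones fs - {k, i}" "k \<in> ones fs" "i \<in> ones fs" "k \<noteq> i"
      using es kl fs by auto
    then show ?thesis using es(1) left_moves_iff by blast
  next
    case 3
    define gs where "gs = strip_zeros (fs[i := False, j := False])"
    have ij: "i \<in> ones fs" "j \<in> ones fs"
      using 3 es fs by auto
    then have "i < length fs" "j < length fs"
      by (auto simp: ones_def)
    then have gs: "position gs" "ones gs = ones fs - {i, j}"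
      by (auto simp: gs_def ones_strip_zeros position_strip_zeros ones_list_update)
    then have "gs \<in> set (left_moves fs)"
      using ij es(4) left_moves_iff by blast
    moreover have "ones gs = insert k (ones es) - {l}" "k \<notin> ones es" "l \<in> ones es"
      using 3 es kl fs gs by auto
    then have "gs \<in> set (right_moves es)"
      using gs(1) kl(1) right_moves_iff by blast
    ultimately show ?thesis by blast
  qed
qed

lemma left_opts_coins_game: "left_opts (coins_game ds) = coins_game |`| fset_of_list (left_moves ds)"
  by (subst coins_game.simps) simp

lemma right_opts_coins_game: "right_opts (coins_game ds) = coins_game |`| fset_of_list (right_moves ds)"
  by (subst coins_game.simps) simp

text \<open>Induction on \<open>weight\<close> covers \<open>gs\<close>, two moves below
  \<open>ds\<close>, as well as the options. It works for arbitrary lists, stripped or not.\<close>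

lemma coins_game_has_value: "\<exists>x. has_value (coins_game ds) x"
proof (induction "weight ds" arbitrary: ds rule: less_induct)
  case less
  show ?case
  proof (rule has_value_if_opts_separated)
    show "\<exists>l. has_value L l" if "L |\<in>| left_opts (coins_game ds)" for L
      using that less left_moves_weight by (auto simp: left_opts_coins_game fset_of_list_elem)
    show "\<exists>r. has_value R r" if "R |\<in>| right_opts (coins_game ds)" for R
      using that less right_moves_weight by (auto simp: right_opts_coins_game fset_of_list_elem)
    fix L R assume "L |\<in>| left_opts (coins_game ds)" "R |\<in>| right_opts (coins_game ds)"
    then obtain es fs where es: "es \<in> set (left_moves ds)" "L = coins_game es"
      and fs: "fs \<in> set (right_moves ds)" "R = coins_game fs"
      by (auto simp: left_opts_coins_game right_opts_coins_game fset_of_list_elem)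
    from moves_interact[OF es(1) fs(1)] show "\<not> R \<le>\<^sub>g L"
    proof (elim disjE exE conjE)
      assume "es \<in> set (left_moves fs)"
      then have "L |\<in>| left_opts R"
        by (auto simp: es fs left_opts_coins_game fset_of_list_elem)
      then show ?thesis by (rule not_le_left_opt)
    next
      fix gs assume gs: "gs \<in> set (right_moves es)" "gs \<in> set (left_moves fs)"
      let ?M = "coins_game gs"
      have "?M |\<in>| right_opts L" "?M |\<in>| left_opts R"
        using gs by (auto simp: es fs left_opts_coins_game right_opts_coins_game fset_of_list_elem)
      then have *: "\<not> ?M \<le>\<^sub>g L" "\<not> R \<le>\<^sub>g ?M"
        using not_right_opt_le not_le_left_opt by blast+
      have "weight es < weight ds" "weight fs < weight ds" "weight gs < weight ds"
        using left_moves_weight[OF es(1)] right_moves_weight[OF fs(1)] right_moves_weight[OF gs(1)] by auto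
      from this[THEN less] obtain l r m where v: "has_value L l" "has_value R r" "has_value ?M m"
        unfolding es(2) fs(2) by blast
      \<comment> \<open>In a partial order the two failures in \<open>*\<close> would not chain.
        Between numbers they become strict inequalities, which do.\<close>
      have "l < m" "m < r"
        using * has_value_le_iff[OF v(3,1)] has_value_le_iff[OF v(2,3)] by auto
      then show ?thesis
        using has_value_le_iff[OF v(2,1)] by simp
    qed
  qed
qed

theorem theorem3p2:
  fixes ds :: "bool list"
  assumes "position ds"
  shows "\<exists>(m::int) (n::nat). coins_game ds =\<^sub>g dyadic_game m n"
  using coins_game_has_value[of ds] game_eqI
  unfolding has_value_def dyadic_value_def by blast

end
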